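(* Let $n\ge 2$. Every deterministic synchronous mutual search algorithm for two agents on $n$ sites has cost at least $(4-2\sqrt{3})(n-1)$ (approximately $0.536n$).
   Context: Setting: two agents sit at two distinct (unknown) sites among $V=\{0,\ldots,n-1\}$ and find each other by queries "is there an agent at site $j$?"; search stops at the first successful query. A deterministic synchronous mutual search (MS) algorithm is an ordered tournament $T=(V,E,\prec)$: $E$ contains, for each unordered pair $\{i,j\}$ of distinct sites, exactly one of the arcs $(i,j)$, $(j,i)$ (arc $(i,j)$: an agent at $i$ queries $j$), and $\prec$ is a total order on $E$ (time order of queries). Row $E_i$ is the set of arcs leaving $i$. The cost of an arc $e=(i,j)$ is $c(e)=|\{f\in E_i: f\prec e\}|+1+|\{f\in E_j: f\prec e\}|$ (number of queries made until contact when the agents are at $i$ and $j$), and the cost of $T$ is $\max_{e\in E}c(e)$. *)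

theory Defs
  imports Complex_Main
begin

text \<open>An arc \<open>(i, j)\<close> means that an agent at site \<open>i\<close> queries site \<open>j\<close>.\<close>

type_synonym arc = "nat \<times> nat"

definition tournament :: "nat \<Rightarrow> arc set \<Rightarrow> bool" where
  "tournament n E \<longleftrightarrow>
     E \<subseteq> {0..<n} \<times> {0..<n} \<and>
     (\<forall>i\<in>{0..<n}. (i, i) \<notin> E) \<and>
     (\<forall>i\<in>{0..<n}. \<forall>j\<in>{0..<n}. i \<noteq> j \<longrightarrow> ((i, j) \<in> E) \<noteq> ((j, i) \<in> E))"

text \<open>
  The time order \<open>R\<close> is the strict order as a set of pairs: \<open>(f, e) \<in> R\<close> iff the query \<open>f\<close>
  is made before the query \<open>e\<close>.
\<close>

definition ordered_tournament :: "nat \<Rightarrow> arc set \<Rightarrow> (arc \<times> arc) set \<Rightarrow> bool" where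
  "ordered_tournament n E R \<longleftrightarrow>
     tournament n E \<and> R \<subseteq> E \<times> E \<and> strict_linear_order_on E R"

definition row :: "arc set \<Rightarrow> nat \<Rightarrow> arc set" where
  "row E i = {f \<in> E. fst f = i}"

definition arc_cost :: "arc set \<Rightarrow> (arc \<times> arc) set \<Rightarrow> arc \<Rightarrow> nat" where
  "arc_cost E R e =
     card {f \<in> row E (fst e). (f, e) \<in> R} + 1 + card {f \<in> row E (snd e). (f, e) \<in> R}"

text \<open>The maximum is only meaningful for nonempty \<open>E\<close>, that is, for at least two sites.\<close>

definition cost :: "arc set \<Rightarrow> (arc \<times> arc) set \<Rightarrow> nat" where
  "cost E R = Max (arc_cost E R ` E)"

end

theory Submission
  imports Defs
begin

text \<open>
  Let \<open>c\<close> be the cost and call an arc late if at least \<open>c div 2\<close> arcs of its own row precede it.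
  A late arc from \<open>i\<close> to \<open>j\<close> must be made before every late arc of \<open>j\<close>, so late arcs contain no
  cycle. Hence in any nonempty set \<open>S\<close> of sites some site has no late arc into \<open>S\<close>, and so has at
  most \<open>n - |S|\<close> of them, besides never more than \<open>c - c div 2\<close>. Removing such sites one by
  one bounds the number of late arcs by \<open>\<Sum>k<n. min (c - c div 2) k\<close>, and counting all arcs gives
  a quadratic inequality for \<open>c\<close>.
\<close>

text \<open>Greedy removal: the chosen element of \<open>A\<close> contributes at most
  \<open>B (n - card A)\<close>, and deleting it raises the argument of \<open>B\<close> by one. The
  arguments used are thus \<open>n - card A\<close>, ..., \<open>n - 1\<close>, once each.\<close>

lemma sum_le_sum_of_removal:
  fixes L :: "'a \<Rightarrow> nat" and B :: "nat \<Rightarrow> nat"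
  assumes "finite A" "card A \<le> n"
    and "\<And>S. S \<subseteq> A \<Longrightarrow> S \<noteq> {} \<Longrightarrow> \<exists>i\<in>S. L i \<le> B (n - card S)"
  shows "sum L A \<le> sum B {n - card A..<n}"
  using assms
proof (induction "card A" arbitrary: A)
  case 0
  then show ?case by simp
next
  case (Suc m)
  then have "A \<noteq> {}" by auto
  with Suc.prems(3)[of A] obtain i where i: "i \<in> A" "L i \<le> B (n - card A)" by auto
  have card: "card (A - {i}) = m" using Suc.hyps(2) i Suc.prems(1) by simp
  have "sum L (A - {i}) \<le> sum B {n - card (A - {i})..<n}"
  proof (rule Suc.hyps(1))
    show "\<exists>k\<in>S. L k \<le> B (n - card S)" if "S \<subseteq> A - {i}" "S \<noteq> {}" for S
      using that Suc.prems(3)[of S] by blast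
  qed (use card Suc.hyps(2) Suc.prems(1,2) in simp_all)
  also have "n - card (A - {i}) = Suc (n - card A)"
    using card Suc.hyps(2) Suc.prems(2) by simp
  finally have "sum L A \<le> B (n - card A) + sum B {Suc (n - card A)..<n}"
    using i Suc.prems(1) by (simp add: sum.remove)
  also have "\<dots> = sum B {n - card A..<n}"
    using Suc.hyps(2) Suc.prems(2) by (simp add: sum.atLeast_Suc_lessThan)
  finally show ?case .
qed

text \<open>The sum consists of \<open>0 + ... + (d - 1)\<close> and \<open>n - d\<close> copies of
  \<open>d\<close>. This form avoids division and subtraction on the naturals.\<close>

lemma sum_min_const:
  fixes d n :: nat
  assumes "d \<le> n"
  shows "2 * (\<Sum>k<n. min d k) + d * d + d = 2 * n * d"
  using assms
proof (induction n rule: dec_induct)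
  case base
  have "(\<Sum>k<d. min d k) = (\<Sum>k<d. k)" by (intro sum.cong) auto
  moreover have "2 * (\<Sum>k<d. k) + d = d * d" by (induction d) auto
  ultimately show ?case by simp
next
  case (step n)
  then show ?case by (simp add: algebra_simps)
qed

lemma card_tournament:
  assumes "tournament n E"
  shows "2 * card E = n * (n - 1)"
proof -
  let ?V = "{0..<n}"
  have sub: "E \<subseteq> ?V \<times> ?V" using assms by (simp add: tournament_def)
  then have fin: "finite E" by (rule finite_subset) simp
  have "E \<union> E\<inverse> = ?V \<times> ?V - (\<lambda>i. (i, i)) ` ?V"
    using assms unfolding tournament_def by (fastforce simp: image_iff)
  moreover have "E \<inter> E\<inverse> = {}"
    using assms unfolding tournament_def by fastforce
  moreover have "card (?V \<times> ?V - (\<lambda>i. (i, i)) ` ?V) = n * n - n"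
    by (subst card_Diff_subset) (auto simp: card_image inj_on_def)
  ultimately have "card E + card (E\<inverse>) = n * n - n"
    using fin by (metis card_Un_disjoint finite_converse)
  then show ?thesis by (simp add: diff_mult_distrib2)
qed

locale mutual_search =
  fixes n :: nat and E :: "arc set" and R :: "(arc \<times> arc) set"
  assumes ordered: "ordered_tournament n E R"
begin

text \<open>For \<open>e\<close> in row \<open>i\<close> the cardinality is the position of
  \<open>e\<close> in that row, counted from 0. For \<open>e\<close> in another row it counts the
  queries that an agent at \<open>i\<close> makes before \<open>e\<close>.\<close>

definition preds :: "nat \<Rightarrow> arc \<Rightarrow> arc set" where
  "preds i e = {f \<in> row E i. (f, e) \<in> R}"

definition late :: "nat \<Rightarrow> nat \<Rightarrow> arc set" where
  "late h i = {e \<in> row E i. h \<le> card (preds i e)}"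

lemma arcs_subset: "E \<subseteq> {0..<n} \<times> {0..<n}"
  using ordered by (simp add: ordered_tournament_def tournament_def)

lemma finite_arcs: "finite E"
  using arcs_subset by (rule finite_subset) simp

lemma finite_row: "finite (row E i)"
  using finite_arcs by (simp add: row_def)

lemma finite_preds: "finite (preds i e)"
  using finite_row by (simp add: preds_def)

lemma finite_late: "finite (late h i)"
  using finite_row by (simp add: late_def)

lemma arc_neq: "(i, j) \<in> E \<Longrightarrow> i \<noteq> j"
  using ordered arcs_subset by (auto simp: ordered_tournament_def tournament_def)

lemma order_trans: "(e, f) \<in> R \<Longrightarrow> (f, g) \<in> R \<Longrightarrow> (e, g) \<in> R"
  using ordered by (auto simp: ordered_tournament_def strict_linear_order_on_def dest: transD)

lemma order_irrefl: "(e, e) \<notin> R"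
  using ordered by (simp add: ordered_tournament_def strict_linear_order_on_def irrefl_def
      del: split_paired_All)

lemma order_total: "e \<in> E \<Longrightarrow> f \<in> E \<Longrightarrow> e \<noteq> f \<Longrightarrow> (e, f) \<in> R \<or> (f, e) \<in> R"
  using ordered by (auto simp: ordered_tournament_def strict_linear_order_on_def total_on_def)

text \<open>Strictness comes from \<open>f\<close> itself. The arc \<open>e\<close> may lie outside
  row \<open>i\<close>, as it does in \<open>late_target\<close>.\<close>

lemma card_preds_less:
  assumes "f \<in> row E i" "(f, e) \<in> R"
  shows "card (preds i f) < card (preds i e)"
proof (rule psubset_card_mono[OF finite_preds])
  show "preds i f \<subset> preds i e"
    using assms order_trans order_irrefl by (fastforce simp: preds_def)
qed

lemma inj_on_card_preds: "inj_on (\<lambda>e. card (preds i e)) (row E i)"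
proof (rule inj_onI, rule ccontr)
  fix e f
  assume "e \<in> row E i" "f \<in> row E i" "card (preds i e) = card (preds i f)" "e \<noteq> f"
  then show False
    using order_total[of e f] card_preds_less[of e i f] card_preds_less[of f i e]
    by (auto simp: row_def)
qed

lemma arc_cost_le: "e \<in> E \<Longrightarrow> card (preds (fst e) e) + 1 + card (preds (snd e) e) \<le> cost E R"
  unfolding cost_def preds_def arc_cost_def[symmetric] using finite_arcs by simp

text \<open>Positions within a row are distinct, and the cost of an arc exceeds its
  position.\<close>

lemma card_late_le: "card (late h i) \<le> cost E R - h"
proof -
  have "card (late h i) \<le> card {h..<cost E R}"
  proof (rule card_inj_on_le)
    show "inj_on (\<lambda>e. card (preds i e)) (late h i)"
      by (rule inj_on_subset[OF inj_on_card_preds]) (auto simp: late_def)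
    show "(\<lambda>e. card (preds i e)) ` late h i \<subseteq> {h..<cost E R}"
      using arc_cost_le by (fastforce simp: late_def row_def)
  qed simp
  then show ?thesis by simp
qed

lemma card_row_le: "card (row E i) \<le> h + card (late h i)"
proof -
  have "card (row E i - late h i) \<le> card {0..<h}"
  proof (rule card_inj_on_le)
    show "inj_on (\<lambda>e. card (preds i e)) (row E i - late h i)"
      by (rule inj_on_subset[OF inj_on_card_preds]) auto
  qed (auto simp: late_def)
  moreover have "card (row E i) \<le> card (row E i - late h i) + card (late h i)"
    using diff_card_le_card_Diff[OF finite_late, of "row E i" h i] by linarith
  ultimately show ?thesis by simp
qed

lemma card_arcs_eq: "card E = (\<Sum>i<n. card (row E i))"
proof -
  have "E = (\<Union>i<n. row E i)" using arcs_subset by (fastforce simp: row_def)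
  moreover have "card (\<Union>i<n. row E i) = (\<Sum>i<n. card (row E i))"
    by (rule card_UN_disjoint) (auto simp: finite_row, auto simp: row_def)
  ultimately show ?thesis by simp
qed

text \<open>If \<open>f\<close> came first, then \<open>f\<close> and its at least \<open>h\<close>
  predecessors in row \<open>j\<close> would precede \<open>(i, j)\<close>, as do at least
  \<open>h\<close> arcs of row \<open>i\<close>. With the query \<open>(i, j)\<close> itself the
  cost would reach \<open>2 * h + 2\<close>.\<close>

lemma late_target:
  assumes e: "(i, j) \<in> late h i" and f: "f \<in> late h j" and c: "cost E R \<le> 2 * h + 1"
  shows "((i, j), f) \<in> R"
proof (rule ccontr)
  assume "((i, j), f) \<notin> R"
  moreover have "(i, j) \<in> E" "f \<in> E" "f \<noteq> (i, j)"
    using e f arc_neq[of i j] by (cases f; auto simp: late_def row_def)+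
  ultimately have "(f, (i, j)) \<in> R" using order_total by blast
  then have "h < card (preds j (i, j))"
    using f card_preds_less[of f j "(i, j)"] by (simp add: late_def)
  moreover have "h \<le> card (preds i (i, j))" using e by (simp add: late_def)
  ultimately show False using arc_cost_le[OF \<open>(i, j) \<in> E\<close>] c by simp
qed

lemma exists_few_late:
  assumes S: "S \<subseteq> {..<n}" "S \<noteq> {}" and c: "cost E R \<le> 2 * h + 1"
  shows "\<exists>i\<in>S. card (late h i) \<le> n - card S"
proof -
  have finS: "finite S" using S(1) finite_subset by blast
  have "\<exists>i\<in>S. \<forall>j\<in>S. (i, j) \<notin> late h i"
  proof (rule ccontr)
    assume "\<not> ?thesis"
    then obtain s where s: "\<And>i. i \<in> S \<Longrightarrow> s i \<in> S \<and> (i, s i) \<in> late h i" by metis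
    \<comment> \<open>Following late arcs inside \<open>S\<close> yields ever later arcs.\<close>
    let ?a = "\<lambda>i. (i, s i)"
    let ?rank = "\<lambda>i. card {f \<in> E. (f, ?a i) \<in> R}"
    have "Max (?rank ` S) \<in> ?rank ` S" using finS S(2) by simp
    then obtain i where "i \<in> S" "Max (?rank ` S) = ?rank i" by (rule imageE)
    then have i: "i \<in> S" "\<And>j. j \<in> S \<Longrightarrow> ?rank j \<le> ?rank i"
      using Max_ge[of "?rank ` S"] finS by force+
    let ?j = "s i"
    have j: "?j \<in> S" using s i by blast
    have lt: "(?a i, ?a ?j) \<in> R" using late_target[of i ?j h "?a ?j"] s i j c by blast
    have "?a i \<in> E" using s i by (auto simp: late_def row_def)
    then have "{f \<in> E. (f, ?a i) \<in> R} \<subset> {f \<in> E. (f, ?a ?j) \<in> R}"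
      using lt order_trans order_irrefl by blast
    then have "?rank i < ?rank ?j"
      by (rule psubset_card_mono[rotated]) (simp add: finite_arcs)
    then show False using i(2)[OF j] by simp
  qed
  then obtain i where i: "i \<in> S" "\<And>j. j \<in> S \<Longrightarrow> (i, j) \<notin> late h i" by blast
  \<comment> \<open>Arcs of one row are determined by their targets, which here all lie outside
    \<open>S\<close>.\<close>
  have "card (late h i) \<le> card ({..<n} - S)"
  proof (rule card_inj_on_le)
    show "inj_on snd (late h i)" by (auto simp: late_def row_def inj_on_def)
    show "snd ` late h i \<subseteq> {..<n} - S"
      using i(2) arcs_subset by (auto simp: late_def row_def)
  qed simp
  also have "\<dots> = n - card S" using S(1) finS by (simp add: card_Diff_subset)
  finally show ?thesis using i(1) by blast
qed

text \<open>This \<open>h\<close> is the least one with \<open>cost E R \<le> 2 * h + 1\<close>, as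
  \<open>exists_few_late\<close> requires. Each row has at most \<open>h\<close> arcs that are not
  late.\<close>

lemma card_arcs_le:
  assumes "h = cost E R div 2"
  shows "card E \<le> n * h + (\<Sum>k<n. min (cost E R - h) k)"
proof -
  have "(\<Sum>i<n. card (late h i)) \<le> sum (min (cost E R - h)) {n - card {..<n}..<n}"
  proof (rule sum_le_sum_of_removal)
    fix S assume "S \<subseteq> {..<n}" "S \<noteq> {}"
    then show "\<exists>i\<in>S. card (late h i) \<le> min (cost E R - h) (n - card S)"
      using exists_few_late[of S h] card_late_le[of h] assms by auto
  qed auto
  moreover have "card E \<le> (\<Sum>i<n. h + card (late h i))"
    unfolding card_arcs_eq by (intro sum_mono card_row_le)
  ultimately show ?thesis by (simp add: sum.distrib atLeast0LessThan)
qed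

text \<open>Writing \<open>c = h + d\<close>, the count becomes
  \<open>n * (n - 1) \<le> 2 * n * c - d * d - d\<close>. Since \<open>d\<close> is half of
  \<open>c\<close> rounded up, \<open>c \<le> 2 * d\<close> eliminates \<open>d\<close> for either
  parity of \<open>c\<close>.\<close>

lemma cost_quadratic:
  assumes "cost E R \<le> n"
  shows "4 * (real n * (real n - 1)) \<le> 8 * real n * cost E R - (real (cost E R))\<^sup>2 - 2 * cost E R"
proof -
  define h where "h = cost E R div 2"
  define d where "d = cost E R - h"
  have c: "cost E R = h + d" and hd: "h \<le> d" "d \<le> n"
    using assms by (auto simp: h_def d_def)
  have "n * (n - 1) \<le> 2 * (n * h) + 2 * (\<Sum>k<n. min d k)"
    using card_arcs_le[OF h_def] card_tournament[of n E] ordered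
    by (simp add: ordered_tournament_def d_def)
  then have "n * (n - 1) + d * d + d \<le> 2 * n * cost E R"
    using sum_min_const[OF hd(2)] by (simp add: c algebra_simps)
  then have "real (n * (n - 1) + d * d + d) \<le> real (2 * n * cost E R)"
    by (simp only: of_nat_le_iff)
  then have "real n * (real n - 1) + (real d)\<^sup>2 + d \<le> 2 * real n * cost E R"
    by (cases n) (simp_all add: power2_eq_square algebra_simps)
  moreover have "(real (cost E R))\<^sup>2 \<le> (2 * real d)\<^sup>2"
    using hd(1) c by (intro power_mono) auto
  moreover have "real (cost E R) \<le> 2 * real d" using hd(1) c by simp
  ultimately show ?thesis by (simp add: power2_eq_square)
qed

end

theorem theorem1:
  fixes n :: nat and E :: "arc set" and R :: "(arc \<times> arc) set"
  assumes "n \<ge> 2"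
    and "ordered_tournament n E R"
  shows "real (cost E R) \<ge> (4 - 2 * sqrt 3) * (real n - 1)"
proof -
  interpret mutual_search n E R by (unfold_locales) (rule assms(2))
  define m where "m = real n - 1"
  define c where "c = real (cost E R)"
  have m: "m \<ge> 1" using assms(1) by (simp add: m_def)
  have "5 / 3 \<le> sqrt 3" by (rule real_le_rsqrt) (simp add: power2_eq_square)
  then have small: "(4 - 2 * sqrt 3) * m \<le> 2 / 3 * m" using m by (intro mult_right_mono) auto
  have "(4 - 2 * sqrt 3) * m \<le> c"
  \<comment> \<open>Above \<open>2 / 3 * m\<close> the claim is immediate from \<open>small\<close>;
    below it the cost is at most \<open>n\<close> and the quadratic bound applies.\<close>
  proof (cases "c \<le> 2 / 3 * m")
    case True
    then have "cost E R \<le> n" using m by (simp add: c_def m_def)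
    from cost_quadratic[OF this]
    have "4 * ((m + 1) * m) \<le> 8 * (m + 1) * c - c\<^sup>2 - 2 * c"
      by (simp add: m_def c_def)
    \<comment> \<open>Completing the square leaves the error term \<open>6 * c - 4 * m\<close> on
      the right. It is nonpositive exactly when \<open>c \<le> 2 / 3 * m\<close>, hence the
      threshold of the case split.\<close>
    then have "(4 * m - c)\<^sup>2 \<le> 12 * m\<^sup>2"
      using True by (simp add: power2_eq_square algebra_simps)
    also have "\<dots> = (2 * sqrt 3 * m)\<^sup>2" by (simp add: power_mult_distrib)
    finally have "4 * m - c \<le> 2 * sqrt 3 * m"
      by (rule power2_le_imp_le) (use m in simp)
    then show ?thesis by (simp add: algebra_simps)
  next
    case False
    then show ?thesis using small by simp
  qed
  then show ?thesis by (simp add: m_def c_def)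
qed

end
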